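(* Let $\mathbb{K}$ be a field and let $n$ be an arbitrary non-negative integer. Every range-compatible $\mathbb{K}$-linear map $F : \mathrm{A}_n(\mathbb{K}) \to \mathbb{K}^n$ is local.
   Context: $\mathbb{K}$ is an arbitrary field. $\mathrm{A}_n(\mathbb{K})$ denotes the space of all $n \times n$ alternating matrices with entries in $\mathbb{K}$, i.e. matrices $M$ with $X^T M X = 0$ for all $X \in \mathbb{K}^n$ (equivalently, skew-symmetric with zero diagonal). A map $F : \mathrm{A}_n(\mathbb{K}) \to \mathbb{K}^n$ is range-compatible when $F(M) \in \operatorname{Im} M$ (the column space of $M$) for all $M$. It is local when there exists $X \in \mathbb{K}^n$ such that $F(M) = MX$ for all $M$. *)

theory Defs
  imports "Jordan_Normal_Form.VS_Connect"
begin

definition alternating_mats :: "nat \<Rightarrow> 'a::field mat set" where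
  "alternating_mats n =
    {M \<in> carrier_mat n n. \<forall>x \<in> carrier_vec n. x \<bullet> (M *\<^sub>v x) = 0}"

abbreviation alternating_space :: "nat \<Rightarrow> ('a::field, 'a mat) module" where
  "alternating_space n \<equiv> (module_mat TYPE('a) n n)\<lparr>carrier := alternating_mats n\<rparr>"

text \<open>The maps below are total functions on all matrices, but only their values on
  the alternating matrices are relevant.\<close>

definition range_compatible :: "nat \<Rightarrow> ('a::field mat \<Rightarrow> 'a vec) \<Rightarrow> bool" where
  "range_compatible n F \<longleftrightarrow> (\<forall>M \<in> alternating_mats n. F M \<in> vec_space.col_space n M)"

definition is_local :: "nat \<Rightarrow> ('a::field mat \<Rightarrow> 'a vec) \<Rightarrow> bool" where
  "is_local n F \<longleftrightarrow> (\<exists>x \<in> carrier_vec n. \<forall>M \<in> alternating_mats n. F M = M *\<^sub>v x)"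

text \<open>The locale predicate \<open>linear_map\<close> also asserts that its source and target are vector
  spaces; the following shows that this holds here, so that it amounts to additivity
  and homogeneity.\<close>

lemma alternating_space_vs:
  "vectorspace class_ring (alternating_space n :: ('a::field, 'a mat) module)"
proof -
  interpret V: vectorspace "class_ring :: 'a ring" "module_mat TYPE('a) n n"
    by (rule matrix_vs)
  have "submodule class_ring (alternating_mats n) (module_mat TYPE('a) n n)"
  proof (rule submodule.intro)
    show "alternating_mats n \<subseteq> carrier (module_mat TYPE('a) n n)"
      by (auto simp: alternating_mats_def module_mat_simps)
  next
    show "\<zero>\<^bsub>module_mat TYPE('a) n n\<^esub> \<in> alternating_mats n"
    proof -
      have "0\<^sub>m n n *\<^sub>v x = 0\<^sub>v n" if "x \<in> carrier_vec n" for x :: "'a vec"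
        using that by (intro eq_vecI) auto
      then show ?thesis
        by (simp add: alternating_mats_def module_mat_simps)
    qed
  next
    fix v w :: "'a mat"
    assume "v \<in> alternating_mats n" "w \<in> alternating_mats n"
    then show "v \<oplus>\<^bsub>module_mat TYPE('a) n n\<^esub> w \<in> alternating_mats n"
      by (auto simp: alternating_mats_def module_mat_simps add_mult_distrib_mat_vec[of _ n n]
          scalar_prod_add_distrib[of _ n])
  next
    fix c :: 'a and v :: "'a mat"
    assume v: "v \<in> alternating_mats n"
    then show "c \<odot>\<^bsub>module_mat TYPE('a) n n\<^esub> v \<in> alternating_mats n"
    proof -
      have "(c \<cdot>\<^sub>m v) *\<^sub>v x = c \<cdot>\<^sub>v (v *\<^sub>v x)"
        if "v \<in> carrier_mat n n" "x \<in> carrier_vec n" for v x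
        using that by (intro eq_vecI) auto
      with v show ?thesis
        by (auto simp: alternating_mats_def module_mat_simps)
    qed
  qed (rule V.module_axioms)
  then have "subspace class_ring (alternating_mats n) (module_mat TYPE('a) n n)"
    by (simp add: subspace_def V.vectorspace_axioms)
  from V.subspace_is_vs[OF this] show ?thesis .
qed

lemma linear_map_alternating_iff:
  fixes F :: "'a::field mat \<Rightarrow> 'a vec"
  shows "linear_map class_ring (alternating_space n) (module_vec TYPE('a) n) F \<longleftrightarrow>
    (\<forall>M \<in> alternating_mats n. F M \<in> carrier_vec n) \<and>
    (\<forall>M \<in> alternating_mats n. \<forall>N \<in> alternating_mats n. F (M + N) = F M + F N) \<and>
    (\<forall>c. \<forall>M \<in> alternating_mats n. F (c \<cdot>\<^sub>m M) = c \<cdot>\<^sub>v F M)"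
proof -
  have V: "vectorspace class_ring (alternating_space n :: ('a, 'a mat) module)"
    by (rule alternating_space_vs)
  have W: "vectorspace class_ring (module_vec TYPE('a) n)"
    by (rule vec_vs)
  show ?thesis
    using V W vectorspace.axioms(1)[OF V] vectorspace.axioms(1)[OF W]
    by (auto simp: linear_map_def mod_hom_def mod_hom_axioms_def LinearCombinations.module_hom_def
        module_mat_simps module_vec_simps)
qed

end

theory Submission
  imports Defs
begin

text \<open>Write \<open>e\<^sub>i \<and> e\<^sub>j\<close> for the elementary alternating matrices. Range-compatibility at
  \<open>e\<^sub>i \<and> e\<^sub>j\<close> gives \<open>F (e\<^sub>i \<and> e\<^sub>j) = c\<^sub>i\<^sub>j e\<^sub>i - c\<^sub>j\<^sub>i e\<^sub>j\<close>, and at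
  \<open>(e\<^sub>i + e\<^sub>k) \<and> e\<^sub>j\<close> it forces \<open>c\<^sub>i\<^sub>j = c\<^sub>k\<^sub>j\<close>. Hence \<open>c\<^sub>i\<^sub>j\<close> depends only on \<open>j\<close>, and the vector
  with these entries represents \<open>F\<close> on a spanning family.\<close>

text \<open>The matrix \<open>u v^T - v u^T\<close>. Arguments are vectors rather than indices so
  that the bilinear identity for \<open>(e_i + e_k)\<close> wedged with \<open>e_j\<close> can be
  used directly.\<close>

definition wedge :: "nat \<Rightarrow> 'a::field vec \<Rightarrow> 'a vec \<Rightarrow> 'a mat" where
  "wedge n u v = mat n n (\<lambda>(a, b). u $ a * v $ b - v $ a * u $ b)"

lemma wedge_carrier [simp]: "wedge n u v \<in> carrier_mat n n"
  by (simp add: wedge_def)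

lemma wedge_mult_vec:
  assumes "u \<in> carrier_vec n" "v \<in> carrier_vec n" "y \<in> carrier_vec n"
  shows "wedge n u v *\<^sub>v y = (v \<bullet> y) \<cdot>\<^sub>v u - (u \<bullet> y) \<cdot>\<^sub>v v"
  using assms
  by (intro eq_vecI)
    (auto simp: wedge_def scalar_prod_def sum_distrib_left algebra_simps
      simp flip: sum_subtractf)

lemma wedge_alternating:
  assumes "u \<in> carrier_vec n" "v \<in> carrier_vec n"
  shows "wedge n u v \<in> alternating_mats n"
  using assms
  by (auto simp: alternating_mats_def wedge_mult_vec scalar_prod_minus_distrib[of _ n]
      comm_scalar_prod[of _ n])

lemma wedge_add_left:
  assumes "u \<in> carrier_vec n" "w \<in> carrier_vec n"
  shows "wedge n (u + w) v = wedge n u v + wedge n w v"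
  using assms by (intro eq_matI) (auto simp: wedge_def algebra_simps)

lemma wedge_swap: "wedge n v u = (-1) \<cdot>\<^sub>m wedge n u v"
  by (intro eq_matI) (auto simp: wedge_def algebra_simps)

lemma alternating_mats_carrier: "M \<in> alternating_mats n \<Longrightarrow> M \<in> carrier_mat n n"
  by (simp add: alternating_mats_def)

lemma alternating_mats_add:
  assumes "M \<in> alternating_mats n" "N \<in> alternating_mats n"
  shows "M + N \<in> alternating_mats n"
  using assms
  by (auto simp: alternating_mats_def add_mult_distrib_mat_vec[of _ n n]
      scalar_prod_add_distrib[of _ n])

lemma smult_mat_mult_vec:
  fixes M :: "'a::field mat"
  assumes "M \<in> carrier_mat n m" "x \<in> carrier_vec m"
  shows "(c \<cdot>\<^sub>m M) *\<^sub>v x = c \<cdot>\<^sub>v (M *\<^sub>v x)"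
  using assms by (intro eq_vecI) auto

lemma alternating_mats_smult:
  assumes "M \<in> alternating_mats n"
  shows "c \<cdot>\<^sub>m M \<in> alternating_mats n"
  using assms by (auto simp: alternating_mats_def smult_mat_mult_vec[of _ n n])

lemma alternating_mats_diag:
  assumes "M \<in> alternating_mats n" "i < n"
  shows "M $$ (i, i) = 0"
proof -
  have "unit_vec n i \<bullet> (M *\<^sub>v unit_vec n i) = 0" "M \<in> carrier_mat n n"
    using assms by (auto simp: alternating_mats_def)
  then show ?thesis
    using assms by auto
qed

text \<open>Polarization: expand the quadratic form at \<open>e_i + e_j\<close>; the two diagonal
  terms vanish, leaving the sum of the mixed entries.\<close>

lemma alternating_mats_skew:
  fixes M :: "'a::field mat"
  assumes M: "M \<in> alternating_mats n" and "i < n" "j < n"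
  shows "M $$ (j, i) = - M $$ (i, j)"
proof -
  let ?e = "unit_vec n :: nat \<Rightarrow> 'a vec"
  have C: "M \<in> carrier_mat n n" and "(?e i + ?e j) \<bullet> (M *\<^sub>v (?e i + ?e j)) = 0"
    using M by (auto simp: alternating_mats_def)
  moreover have "M *\<^sub>v (?e i + ?e j) = M *\<^sub>v ?e i + M *\<^sub>v ?e j"
    using C by (simp add: mult_add_distrib_mat_vec)
  moreover have "M *\<^sub>v ?e i \<in> carrier_vec n" "M *\<^sub>v ?e j \<in> carrier_vec n"
    using C by auto
  ultimately have "M $$ (i, i) + M $$ (j, i) + (M $$ (i, j) + M $$ (j, j)) = 0"
    using assms(2,3)
    by (simp add: add_scalar_prod_distrib[of _ n] scalar_prod_add_distrib[of _ n] algebra_simps)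
  then show ?thesis
    using alternating_mats_diag[OF M] assms(2,3) by (simp add: add_eq_0_iff)
qed

text \<open>By \<open>wedge_mult_vec\<close> the image of \<open>wedge n u v\<close> lies in the
  span of \<open>u\<close> and \<open>v\<close>. This is the only way range-compatibility enters the
  main proof.\<close>

lemma range_compatible_wedge:
  assumes "range_compatible n F" "u \<in> carrier_vec n" "v \<in> carrier_vec n"
  obtains a b where "F (wedge n u v) = a \<cdot>\<^sub>v u - b \<cdot>\<^sub>v v"
proof -
  have "F (wedge n u v) \<in> vec_space.col_space n (wedge n u v)"
    using assms wedge_alternating by (auto simp: range_compatible_def)
  then obtain y where "y \<in> carrier_vec n" "F (wedge n u v) = wedge n u v *\<^sub>v y"
    by (auto simp: vec_space.col_space_eq[OF wedge_carrier] carrier_matD[OF wedge_carrier])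
  then show thesis
    using that assms(2,3) by (simp add: wedge_mult_vec)
qed

text \<open>An alternating matrix is determined by its entries above the diagonal, and these can be
  cleared one at a time by subtracting multiples of wedges of unit vectors.\<close>

lemma alternating_mats_induct [consumes 1, case_names zero wedge]:
  fixes M :: "'a::field mat"
  assumes M: "M \<in> alternating_mats n"
    and zero: "P (0\<^sub>m n n)"
    and step: "\<And>M c i j. M \<in> alternating_mats n \<Longrightarrow> P M \<Longrightarrow> i < j \<Longrightarrow> j < n \<Longrightarrow>
      P (M + c \<cdot>\<^sub>m wedge n (unit_vec n i) (unit_vec n j))"
  shows "P M"
proof -
  \<comment> \<open>Generalized for induction: \<open>S\<close> is a finite set of positions
    containing every nonzero entry above the diagonal.\<close>
  have "P M"
    if "finite S" "S \<subseteq> {(i, j). i < j \<and> j < n}" "M \<in> alternating_mats n"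
      "\<And>i j. i < j \<Longrightarrow> j < n \<Longrightarrow> (i, j) \<notin> S \<Longrightarrow> M $$ (i, j) = 0" for S M
    using that
  proof (induction S arbitrary: M rule: finite_induct)
    case empty
    have "M $$ (i, j) = 0" if "i < n" "j < n" for i j
      using empty.prems that alternating_mats_diag[of M n i] alternating_mats_skew[of M n j i]
      by (cases i j rule: linorder_cases) auto
    then have "M = 0\<^sub>m n n"
      using alternating_mats_carrier[OF empty.prems(2)] by (intro eq_matI) auto
    with zero show ?case by simp
  next
    case (insert p S)
    obtain i j where p: "p = (i, j)" "i < j" "j < n"
      using insert.prems(1) by auto
    let ?E = "wedge n (unit_vec n i) (unit_vec n j) :: 'a mat"
    let ?c = "M $$ (i, j)"
    define N where "N = M + (- ?c) \<cdot>\<^sub>m ?E"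
    have C: "M \<in> carrier_mat n n"
      using insert.prems(2) by (rule alternating_mats_carrier)
    have N: "N \<in> alternating_mats n"
      unfolding N_def
      by (intro alternating_mats_add alternating_mats_smult wedge_alternating insert.prems(2))
        auto
    have "P N"
    proof (rule insert.IH[OF _ N])
      fix a b assume ab: "a < b" "b < n" "(a, b) \<notin> S"
      \<comment> \<open>The entry -1 of \<open>?E\<close> sits at \<open>(j, i)\<close>, which
        \<open>a < b\<close> and \<open>i < j\<close> exclude; so passing to \<open>N\<close>
        changes only position \<open>(i, j)\<close> above the diagonal.\<close>
      have "?E $$ (a, b) = (if (a, b) = (i, j) then 1 else 0)"
        using ab p by (auto simp: wedge_def)
      then show "N $$ (a, b) = 0"
        using ab p C insert.prems(3)[of a b] by (auto simp: N_def wedge_def)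
    qed (use insert.prems in auto)
    then have "P (N + ?c \<cdot>\<^sub>m ?E)"
      using step N p by blast
    also have "N + ?c \<cdot>\<^sub>m ?E = M"
      using C by (intro eq_matI) (auto simp: N_def wedge_def)
    finally show ?case .
  qed
  moreover have "finite {(i, j). i < j \<and> j < n}"
    by (rule finite_subset[of _ "{..<n} \<times> {..<n}"]) auto
  ultimately show ?thesis
    using M by blast
qed

theorem theorem1p8:
  fixes F :: "'a::field mat \<Rightarrow> 'a vec" and n :: nat
  assumes "linear_map class_ring (alternating_space n) (module_vec TYPE('a) n) F"
    and "range_compatible n F"
  shows "is_local n F"
proof -
  let ?e = "unit_vec n :: nat \<Rightarrow> 'a vec"
  let ?E = "\<lambda>i j. wedge n (?e i) (?e j)"
  have carr: "F M \<in> carrier_vec n" if "M \<in> alternating_mats n" for M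
    using assms(1) that by (simp add: linear_map_alternating_iff)
  have add: "F (M + N) = F M + F N"
    if "M \<in> alternating_mats n" "N \<in> alternating_mats n" for M N
    using assms(1) that by (simp add: linear_map_alternating_iff)
  have smult: "F (c \<cdot>\<^sub>m M) = c \<cdot>\<^sub>v F M" if "M \<in> alternating_mats n" for c M
    using assms(1) that by (simp add: linear_map_alternating_iff)
  have E: "?E i j \<in> alternating_mats n" for i j
    by (simp add: wedge_alternating)
  \<comment> \<open>Here \<open>F (?E i j) $ i\<close> is the coefficient \<open>c_ij\<close> of the
    overview.\<close>
  have indep: "F (?E i j) $ i = F (?E k j) $ k"
    if "i < n" "j < n" "k < n" "i \<noteq> j" "k \<noteq> j" for i j k
  proof (cases "i = k")
    case False
    obtain a b where "F (wedge n (?e i + ?e k) (?e j)) = a \<cdot>\<^sub>v (?e i + ?e k) - b \<cdot>\<^sub>v ?e j"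
      using range_compatible_wedge[OF assms(2), of "?e i + ?e k" "?e j"] by auto
    then have sum: "F (?E i j) + F (?E k j) = a \<cdot>\<^sub>v (?e i + ?e k) - b \<cdot>\<^sub>v ?e j"
      using add[OF E E] by (simp add: wedge_add_left)
    obtain c d where i: "F (?E i j) = c \<cdot>\<^sub>v ?e i - d \<cdot>\<^sub>v ?e j"
      using range_compatible_wedge[OF assms(2), of "?e i" "?e j"] by auto
    obtain c' d' where k: "F (?E k j) = c' \<cdot>\<^sub>v ?e k - d' \<cdot>\<^sub>v ?e j"
      using range_compatible_wedge[OF assms(2), of "?e k" "?e j"] by auto
    \<comment> \<open>Compare coordinates \<open>i\<close> and \<open>k\<close> of
      \<open>sum\<close>: both differ from \<open>j\<close>, so the \<open>?e j\<close> terms drop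
      out and \<open>a\<close> is the shared coefficient.\<close>
    have "c = a" "c' = a"
      using arg_cong[OF sum, of "\<lambda>v. v $ i"] arg_cong[OF sum, of "\<lambda>v. v $ k"] that False i k
      by auto
    with i k that show ?thesis by auto
  qed simp
  \<comment> \<open>By \<open>indep\<close> any index other than \<open>j\<close> gives the same
    entry. For \<open>n = 1\<close> no such index exists and the entry is unspecified, which is
    harmless since \<open>x_eq\<close> is then vacuous.\<close>
  define x where "x = vec n (\<lambda>j. let i = (SOME i. i < n \<and> i \<noteq> j) in F (?E i j) $ i)"
  have x [simp]: "x \<in> carrier_vec n"
    by (simp add: x_def)
  have x_eq: "x $ j = F (?E i j) $ i" if "i < n" "j < n" "i \<noteq> j" for i j
  proof -
    define k where "k = (SOME i. i < n \<and> i \<noteq> j)"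
    have "k < n \<and> k \<noteq> j"
      unfolding k_def by (rule someI[of _ i]) (use that in auto)
    then have "F (?E k j) $ k = F (?E i j) $ i"
      using that by (intro indep) auto
    then show ?thesis
      using that by (simp add: x_def Let_def flip: k_def)
  qed
  \<comment> \<open>Since \<open>?E i j *\<^sub>v x\<close> equals \<open>x_j e_i - x_i e_j\<close>,
    it suffices to match two coefficients; the second is read off from \<open>?E j i\<close>, the
    negative of \<open>?E i j\<close>.\<close>
  have FE: "F (?E i j) = ?E i j *\<^sub>v x" if "i < j" "j < n" for i j
  proof -
    obtain a b where ab: "F (?E i j) = a \<cdot>\<^sub>v ?e i - b \<cdot>\<^sub>v ?e j"
      using range_compatible_wedge[OF assms(2), of "?e i" "?e j"] by auto
    have "x $ j = a"
      using x_eq[of i j] that ab by auto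
    moreover have "x $ i = b"
      using x_eq[of j i] that ab smult[OF E, of "-1" i j] wedge_swap[of n "?e j" "?e i"] by auto
    ultimately show ?thesis
      using ab that by (simp add: wedge_mult_vec)
  qed
  have "F M = M *\<^sub>v x" if "M \<in> alternating_mats n" for M
    using that
  proof (induction rule: alternating_mats_induct)
    case zero
    \<comment> \<open>\<open>?E 0 0\<close> serves as some alternating matrix to scale by 0;
      \<open>E\<close> has no index bounds, so \<open>n = 0\<close> is covered.\<close>
    have "F (0 \<cdot>\<^sub>m ?E 0 0) = 0 \<cdot>\<^sub>v F (?E 0 0)"
      by (rule smult[OF E])
    moreover have "0 \<cdot>\<^sub>m ?E 0 0 = 0\<^sub>m n n"
      by (intro eq_matI) (auto simp: wedge_def)
    moreover have "0 \<cdot>\<^sub>v F (?E 0 0) = 0\<^sub>v n"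
      using carr[OF E, of 0 0] by (intro eq_vecI) auto
    moreover have "0\<^sub>m n n *\<^sub>v x = 0\<^sub>v n"
      using x by (intro eq_vecI) auto
    ultimately show ?case by simp
  next
    case (wedge M c i j)
    then show ?case
      by (simp add: add smult E FE alternating_mats_smult smult_mat_mult_vec[of _ n n]
          add_mult_distrib_mat_vec[of _ n n] alternating_mats_carrier)
  qed
  then show ?thesis
    using x by (auto simp: is_local_def)
qed

end
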